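(* The readability of the graph $G(n)$ is $\Omega\left(\sqrt{\frac{\log n}{\log\log n}}\right)$ as $n\to\infty$; that is, there exist a constant $c>0$ and an integer $N$ such that for all $n\ge N$ the readability of $G(n)$ is at least $c\sqrt{\frac{\log n}{\log\log n}}$.
   Context: For a positive integer $n$, $G(n)$ is the bipartite graph with vertices $x_1,\ldots,x_n$ and $y_1,\ldots,y_n$ whose edges are the pairs $x_iy_j$ with $i\le j$. A (monotone Boolean) formula is a formula built from variables using only the Boolean operations OR (written $+$) and AND (written $*$), with no negations. For a positive integer $k$, a formula is read-$k$ if no variable occurs more than $k$ times in it. For a triangle-free graph $G$ without isolated vertices, let $\phi(G)$ be the formula $\sum_{uv\in E(G)} u*v$, whose variables are the vertices of $G$ and whose terms are the edges of $G$. The readability of $G$ is the smallest $k$ such that there is a read-$k$ monotone Boolean formula logically equivalent to $\phi(G)$; equivalently, a read-$k$ monotone formula whose minterms are precisely the edges of $G$. *)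

theory Defs
  imports Complex_Main
begin

text \<open>Monotone formulas over variables of type \<open>'a\<close>. There are no constants, so every formula
  contains at least one variable.\<close>

datatype (vars: 'a) mform =
    Var 'a
  | Or "'a mform" "'a mform"
  | And "'a mform" "'a mform"

fun eval :: "('a \<Rightarrow> bool) \<Rightarrow> 'a mform \<Rightarrow> bool" where
  "eval \<sigma> (Var v) \<longleftrightarrow> \<sigma> v"
| "eval \<sigma> (Or F H) \<longleftrightarrow> eval \<sigma> F \<or> eval \<sigma> H"
| "eval \<sigma> (And F H) \<longleftrightarrow> eval \<sigma> F \<and> eval \<sigma> H"

definition equivalent :: "'a mform \<Rightarrow> 'a mform \<Rightarrow> bool" where
  "equivalent F H \<longleftrightarrow> (\<forall>\<sigma>. eval \<sigma> F \<longleftrightarrow> eval \<sigma> H)"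

fun occurrences :: "'a mform \<Rightarrow> 'a \<Rightarrow> nat" where
  "occurrences (Var w) v = (if v = w then 1 else 0)"
| "occurrences (Or F H) v = occurrences F v + occurrences H v"
| "occurrences (And F H) v = occurrences F v + occurrences H v"

definition read :: "nat \<Rightarrow> 'a mform \<Rightarrow> bool" where
  "read k F \<longleftrightarrow> (\<forall>v. occurrences F v \<le> k)"

text \<open>A graph is a pair of its vertex set and its set of edges, an edge being the set of its
  two end points.\<close>

type_synonym 'a graph = "'a set \<times> 'a set set"

abbreviation verts :: "'a graph \<Rightarrow> 'a set" where "verts G \<equiv> fst G"
abbreviation edges :: "'a graph \<Rightarrow> 'a set set" where "edges G \<equiv> snd G"

fun sum_of_terms :: "('a \<times> 'a) list \<Rightarrow> 'a mform" where
  "sum_of_terms [] = undefined"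
| "sum_of_terms [(u, v)] = And (Var u) (Var v)"
| "sum_of_terms ((u, v) # e # es) = Or (And (Var u) (Var v)) (sum_of_terms (e # es))"

definition edge_listing :: "'a graph \<Rightarrow> ('a \<times> 'a) list \<Rightarrow> bool" where
  "edge_listing G es \<longleftrightarrow>
     (\<forall>(u, v) \<in> set es. u \<noteq> v) \<and>
     distinct (map (\<lambda>(u, v). {u, v}) es) \<and> set (map (\<lambda>(u, v). {u, v}) es) = edges G"

text \<open>As a syntactic object, the sum over all edges depends on an order of the edges and of their
  end points; any choice gives the same formula up to logical equivalence
  (see \<open>eval_graph_formula\<close>). It is meaningful for finite graphs with at least one edge.\<close>

definition graph_formula :: "'a graph \<Rightarrow> 'a mform" where
  "graph_formula G = sum_of_terms (SOME es. edge_listing G es)"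

definition readability :: "'a graph \<Rightarrow> nat" where
  "readability G =
     (LEAST k. \<exists>F. vars F \<subseteq> verts G \<and> read k F \<and> equivalent F (graph_formula G))"

datatype vertex = X nat | Y nat

definition Gn :: "nat \<Rightarrow> vertex graph" where
  "Gn n = (X ` {1..n} \<union> Y ` {1..n}, {{X i, Y j} | i j. 1 \<le> i \<and> i \<le> j \<and> j \<le> n})"

lemma eval_sum_of_terms:
  "es \<noteq> [] \<Longrightarrow> eval \<sigma> (sum_of_terms es) \<longleftrightarrow> (\<exists>(u, v) \<in> set es. \<sigma> u \<and> \<sigma> v)"
  by (induction es rule: sum_of_terms.induct) auto

lemma vars_sum_of_terms:
  "es \<noteq> [] \<Longrightarrow> vars (sum_of_terms es) = (\<Union>(u, v) \<in> set es. {u, v})"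
  by (induction es rule: sum_of_terms.induct) auto

lemma ex_edge_listing:
  assumes "finite (edges G)" and "\<And>e. e \<in> edges G \<Longrightarrow> \<exists>u v. u \<noteq> v \<and> e = {u, v}"
  shows "\<exists>es. edge_listing G es"
proof -
  obtain es where es: "set es = edges G" "distinct es"
    using finite_distinct_list[OF assms(1)] by blast
  have "\<forall>e\<in>edges G. \<exists>p. fst p \<noteq> snd p \<and> e = {fst p, snd p}"
    using assms(2) by simp
  from bchoice[OF this] obtain f
    where f: "\<And>e. e \<in> edges G \<Longrightarrow> fst (f e) \<noteq> snd (f e) \<and> e = {fst (f e), snd (f e)}"
    by blast
  have "map (\<lambda>(u, v). {u, v}) (map f es) = es"
    unfolding map_map
  proof (rule map_idI)
    fix e assume "e \<in> set es"
    then show "((\<lambda>(u, v). {u, v}) \<circ> f) e = e"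
      using f[of e] es(1) by (metis comp_apply case_prod_beta)
  qed
  moreover have "\<forall>(u, v) \<in> set (map f es). u \<noteq> v"
    using f es(1) by (auto simp: case_prod_beta)
  ultimately show ?thesis
    unfolding edge_listing_def using es by (intro exI[of _ "map f es"]) simp
qed

lemma
  assumes "finite (edges G)" and "edges G \<noteq> {}"
    and "\<And>e. e \<in> edges G \<Longrightarrow> \<exists>u v. u \<noteq> v \<and> e = {u, v}"
  shows eval_graph_formula:
      "eval \<sigma> (graph_formula G) \<longleftrightarrow> (\<exists>u v. {u, v} \<in> edges G \<and> \<sigma> u \<and> \<sigma> v)"
    and vars_graph_formula: "vars (graph_formula G) = \<Union>(edges G)"
proof -
  define es where "es = (SOME es. edge_listing G es)"
  have es: "edge_listing G es"
    unfolding es_def using ex_edge_listing[OF assms(1,3)] by (metis someI_ex)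
  then have set_es: "edges G = (\<lambda>(u, v). {u, v}) ` set es"
    by (auto simp: edge_listing_def)
  with assms(2) have "es \<noteq> []" by auto
  have gf: "graph_formula G = sum_of_terms es"
    by (simp add: graph_formula_def es_def)
  have "(\<exists>(u, v) \<in> set es. \<sigma> u \<and> \<sigma> v) \<longleftrightarrow> (\<exists>u v. {u, v} \<in> edges G \<and> \<sigma> u \<and> \<sigma> v)"
    unfolding set_es by (auto simp: image_iff doubleton_eq_iff) blast+
  with \<open>es \<noteq> []\<close> show "eval \<sigma> (graph_formula G) \<longleftrightarrow> (\<exists>u v. {u, v} \<in> edges G \<and> \<sigma> u \<and> \<sigma> v)"
    by (simp add: gf eval_sum_of_terms)
  from \<open>es \<noteq> []\<close> show "vars (graph_formula G) = \<Union>(edges G)"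
    by (simp add: gf vars_sum_of_terms set_es)
qed

lemma ex_read: "\<exists>k. read k F"
proof (induction F)
  case (Or F H)
  then show ?case unfolding read_def by (metis add_mono occurrences.simps(2))
next
  case (And F H)
  then show ?case unfolding read_def by (metis add_mono occurrences.simps(3))
qed (auto simp: read_def)

text \<open>The minimum in \<open>readability\<close> is attained.\<close>

lemma readability_attained:
  assumes "finite (edges G)" and "edges G \<noteq> {}"
    and "\<And>e. e \<in> edges G \<Longrightarrow> \<exists>u v. u \<noteq> v \<and> e = {u, v}" and "\<Union>(edges G) \<subseteq> verts G"
  shows "\<exists>F. vars F \<subseteq> verts G \<and> read (readability G) F \<and> equivalent F (graph_formula G)"
  unfolding readability_def
proof (rule LeastI_ex)
  obtain k where "read k (graph_formula G)"
    using ex_read by blast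
  then show "\<exists>k F. vars F \<subseteq> verts G \<and> read k F \<and> equivalent F (graph_formula G)"
    using assms(4) vars_graph_formula[OF assms(1,2,3)] unfolding equivalent_def by metis
qed

lemma finite_edges_Gn: "finite (edges (Gn n))"
proof (rule finite_subset)
  show "edges (Gn n) \<subseteq> (\<lambda>(i, j). {X i, Y j}) ` ({1..n} \<times> {1..n})"
  proof
    fix e assume "e \<in> edges (Gn n)"
    then obtain i j where "e = {X i, Y j}" "1 \<le> i" "i \<le> j" "j \<le> n"
      by (auto simp: Gn_def)
    then show "e \<in> (\<lambda>(i, j). {X i, Y j}) ` ({1..n} \<times> {1..n})"
      by (intro image_eqI[of _ _ "(i, j)"]) auto
  qed
qed simp

lemma Gn_simple: "e \<in> edges (Gn n) \<Longrightarrow> \<exists>u v. u \<noteq> v \<and> e = {u, v}"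
  unfolding Gn_def by auto

lemma Gn_triangle_free:
  "\<not> ({u, v} \<in> edges (Gn n) \<and> {v, w} \<in> edges (Gn n) \<and> {u, w} \<in> edges (Gn n))"
  by (auto simp: Gn_def doubleton_eq_iff)

lemma Gn_no_isolated: "\<Union>(edges (Gn n)) = verts (Gn n)"
proof
  show "\<Union>(edges (Gn n)) \<subseteq> verts (Gn n)"
    by (auto simp: Gn_def)
  show "verts (Gn n) \<subseteq> \<Union>(edges (Gn n))"
  proof
    fix v assume "v \<in> verts (Gn n)"
    then obtain i where "1 \<le> i" "i \<le> n" "v \<in> {X i, Y i}"
      by (auto simp: Gn_def)
    moreover from this have "{X i, Y i} \<in> edges (Gn n)"
      by (auto simp: Gn_def)
    ultimately show "v \<in> \<Union>(edges (Gn n))" by blast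
  qed
qed

lemma edges_Gn_nonempty: "n \<ge> 1 \<Longrightarrow> edges (Gn n) \<noteq> {}"
  by (auto simp: Gn_def)

end

theory Submission
  imports Defs
begin

text \<open>Only the values of the formula on pairs \<open>{x, y}\<close> are used. If \<open>x\<close> and \<open>y\<close> together satisfy
  a formula but neither of them does so alone, then, descending from the root, one reaches an AND
  gate with one input satisfied by \<open>x\<close> alone and the other one by \<open>y\<close> alone. For a fixed \<open>x\<close> read
  at most \<open>k\<close> times there are at most \<open>k\<close> such gates, so the same gate serves a \<open>1/k\<close> fraction of
  the vertices \<open>y\<close>. Restricted to these \<open>y\<close>, the input satisfied by \<open>y\<close> is constantly true and can
  be deleted, which saves one occurrence of each remaining \<open>y\<close>. After at most \<open>k\<close> rounds no
  occurrence is left, hence \<open>n - 1 \<le> (k + 1) ^ k\<close>.\<close>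

lemma eval_mono: "eval \<sigma> F \<Longrightarrow> (\<And>v. \<sigma> v \<Longrightarrow> \<tau> v) \<Longrightarrow> eval \<tau> F"
  by (induction F) auto

lemma eval_imp_occurrence: "eval \<sigma> F \<Longrightarrow> \<exists>v. \<sigma> v \<and> 0 < occurrences F v"
  by (induction F) auto

text \<open>Agreement is asked only where some \<open>y\<close> in \<open>J\<close> is true, since
  dropping an AND input may change the formula elsewhere. The first clause preserves the read bounds
  of the other variables.\<close>

definition saves :: "'a mform \<Rightarrow> 'a mform \<Rightarrow> 'a set \<Rightarrow> bool" where
  "saves F F' J \<longleftrightarrow>
     (\<forall>v. occurrences F' v \<le> occurrences F v) \<and>
     (\<forall>y\<in>J. occurrences F' y < occurrences F y) \<and>
     (\<forall>\<sigma>. \<forall>y\<in>J. \<sigma> y \<longrightarrow> eval \<sigma> F' = eval \<sigma> F)"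

text \<open>At least a \<open>1/c\<close> fraction of \<open>J\<close> survives; the product form
  also admits \<open>c = 0\<close>.\<close>

definition reducible :: "'a mform \<Rightarrow> 'a set \<Rightarrow> nat \<Rightarrow> bool" where
  "reducible F J c \<longleftrightarrow> (\<exists>J' F'. J' \<subseteq> J \<and> card J \<le> c * card J' \<and> saves F F' J')"

lemma reducible_mono: "reducible F J c \<Longrightarrow> c \<le> d \<Longrightarrow> reducible F J d"
  unfolding reducible_def by (meson le_trans mult_le_mono1)

lemma reducible_empty: "reducible F {} c"
  unfolding reducible_def saves_def by (intro exI[of _ "{}"] exI[of _ F]) auto

text \<open>The larger of the two surviving sets serves the whole union:
  \<open>c * card J' + d * card K'\<close> is at most \<open>c + d\<close> times the larger
  cardinality.\<close>

lemma reducible_Un: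
  assumes "reducible F J c" and "reducible F K d"
  shows "reducible F (J \<union> K) (c + d)"
proof -
  obtain J' F1 where J': "J' \<subseteq> J" "card J \<le> c * card J'" "saves F F1 J'"
    using assms(1) unfolding reducible_def by blast
  obtain K' F2 where K': "K' \<subseteq> K" "card K \<le> d * card K'" "saves F F2 K'"
    using assms(2) unfolding reducible_def by blast
  have le: "card (J \<union> K) \<le> c * card J' + d * card K'"
    using card_Un_le[of J K] J'(2) K'(2) by linarith
  show ?thesis
  proof (cases "card J' \<le> card K'")
    case True
    then have "c * card J' \<le> c * card K'" by simp
    with le have "card (J \<union> K) \<le> (c + d) * card K'"
      unfolding add_mult_distrib by linarith
    with K' show ?thesis unfolding reducible_def by blast
  next
    case False
    then have "d * card K' \<le> d * card J'" by simp
    with le have "card (J \<union> K) \<le> (c + d) * card J'"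
      unfolding add_mult_distrib by linarith
    with J' show ?thesis unfolding reducible_def by blast
  qed
qed

lemma saves_context:
  assumes "saves A A' J"
  shows "saves (Or A B) (Or A' B) J" "saves (Or B A) (Or B A') J"
    "saves (And A B) (And A' B) J" "saves (And B A) (And B A') J"
  using assms unfolding saves_def by auto

lemma reducible_context:
  assumes "reducible A J c"
  shows "reducible (Or A B) J c" "reducible (Or B A) J c"
    "reducible (And A B) J c" "reducible (And B A) J c"
  using assms unfolding reducible_def by (blast intro: saves_context)+

text \<open>By monotonicity \<open>B\<close> is true whenever some \<open>y\<close> in
  \<open>J\<close> is. Being satisfied by \<open>y\<close> alone, \<open>B\<close> contains
  \<open>y\<close>, so deleting it saves an occurrence.\<close>

lemma reducible_delete:
  assumes "\<And>y. y \<in> J \<Longrightarrow> eval (\<lambda>v. v = y) B"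
  shows "reducible (And A B) J 1" "reducible (And B A) J 1"
proof -
  have "0 < occurrences B y" if "y \<in> J" for y
    using eval_imp_occurrence[OF assms[OF that]] by simp
  moreover have "eval \<sigma> B" if "y \<in> J" "\<sigma> y" for \<sigma> y
    using eval_mono[OF assms[OF that(1)]] that(2) by simp
  ultimately show "reducible (And A B) J 1" "reducible (And B A) J 1"
    unfolding reducible_def saves_def by (auto intro!: exI[of _ J] exI[of _ A])
qed

text \<open>The factors of the two inputs of a gate add up in \<open>reducible_Un\<close> exactly as
  the occurrences of \<open>x\<close> do.\<close>

lemma reducible_minterms:
  assumes "\<And>y. y \<in> J \<Longrightarrow> \<not> eval (\<lambda>v. v = x) F \<and> \<not> eval (\<lambda>v. v = y) F \<and>
      eval (\<lambda>v. v = x \<or> v = y) F"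
  shows "reducible F J (occurrences F x)"
  using assms
proof (induction F arbitrary: J)
  case (Var w)
  then have "J = {}" by auto
  then show ?case by (simp add: reducible_empty)
next
  case (Or A B)
  define P where "P H = {y \<in> J. eval (\<lambda>v. v = x \<or> v = y) H}" for H
  have "reducible A (P A) (occurrences A x)" "reducible B (P B) (occurrences B x)"
    using Or.prems by (auto intro!: Or.IH simp: P_def)
  moreover have "J = P A \<union> P B"
    using Or.prems by (auto simp: P_def)
  ultimately show ?case
    using reducible_Un[OF reducible_context(1) reducible_context(2)] by simp
next
  case (And A B)
  \<comment> \<open>\<open>M H\<close> collects the \<open>y\<close> for which \<open>H\<close>
    still needs both vertices, \<open>Q H\<close> those satisfying \<open>H\<close> alone.\<close>
  define M where "M H = {y \<in> J. \<not> eval (\<lambda>v. v = x) H \<and> \<not> eval (\<lambda>v. v = y) H}" for H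
  define Q where "Q H = {y \<in> J. eval (\<lambda>v. v = y) H}" for H
  have A: "reducible (And A B) (M A) (occurrences A x)"
    using And.prems by (auto intro!: reducible_context(3) And.IH simp: M_def)
  have B: "reducible (And A B) (M B) (occurrences B x)"
    using And.prems by (auto intro!: reducible_context(4) And.IH simp: M_def)
  have QA: "reducible (And A B) (Q A) 1" and QB: "reducible (And A B) (Q B) 1"
    by (rule reducible_delete; simp add: Q_def)+
  consider "eval (\<lambda>v. v = x) A" | "eval (\<lambda>v. v = x) B"
    | "\<not> eval (\<lambda>v. v = x) A" "\<not> eval (\<lambda>v. v = x) B"
    by blast
  then show ?case
  proof cases
    case 1
    \<comment> \<open>The factor 1 for deleting \<open>B\<close> is paid by an occurrence of
      \<open>x\<close> in \<open>A\<close>.\<close>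
    then have "J = Q B \<union> M B" "1 \<le> occurrences A x"
      using And.prems eval_imp_occurrence[OF 1] by (auto simp: M_def Q_def)
    then show ?thesis
      using reducible_Un[OF reducible_mono[OF QB] B] by simp
  next
    case 2
    then have "J = M A \<union> Q A" "1 \<le> occurrences B x"
      using And.prems eval_imp_occurrence[OF 2] by (auto simp: M_def Q_def)
    then show ?thesis
      using reducible_Un[OF A reducible_mono[OF QA]] by simp
  next
    case 3
    \<comment> \<open>No \<open>y\<close> satisfies both inputs alone, so each lies in one of the
      two sets.\<close>
    then have "J = M A \<union> M B"
      using And.prems by (auto simp: M_def)
    then show ?thesis
      using reducible_Un[OF A B] by simp
  qed
qed

lemma card_half_graph_le:
  fixes S :: "nat set" and a b :: "nat \<Rightarrow> 'a"
  assumes "finite S" and "inj_on b S"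
    and "\<And>i j. i \<in> S \<Longrightarrow> j \<in> S \<Longrightarrow> eval (\<lambda>v. v = a i \<or> v = b j) F \<longleftrightarrow> i < j"
    and "\<And>i. i \<in> S \<Longrightarrow> occurrences F (a i) \<le> k"
    and "\<And>j. j \<in> S \<Longrightarrow> occurrences F (b j) \<le> m"
  shows "card S \<le> (k + 1) ^ m"
  using assms
proof (induction m arbitrary: S F)
  case 0
  have "i = j" if "i \<in> S" "j \<in> S" for i j
  proof (rule ccontr)
    assume "i \<noteq> j"
    have "\<exists>i\<in>S. \<exists>j\<in>S. i < j"
      using that \<open>i \<noteq> j\<close> by (meson linorder_less_linear)
    then obtain i j where ij: "i \<in> S" "j \<in> S" "i < j" by blast
    \<comment> \<open>As \<open>b j\<close> and \<open>b i\<close> do not occur in \<open>F\<close>,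
      the true pair \<open>(i, j)\<close> has the value of the false pair
      \<open>(i, i)\<close>.\<close>
    have "eval (\<lambda>v. v = a i \<or> v = b j) F = eval (\<lambda>v. v = a i \<or> v = b i) F"
    proof -
      have "eval (\<lambda>v. v = a i \<or> v = y) F = eval (\<lambda>v. v = a i) F" if "occurrences F y = 0" for y
        using that by (induction F) auto
      then show ?thesis using 0(5) ij by simp
    qed
    with ij show False using 0(3) by blast
  qed
  then show ?case
    using card_le_Suc0_iff_eq[OF \<open>finite S\<close>] by auto
next
  case (Suc m)
  show ?case
  proof (cases "S = {}")
    case False
    \<comment> \<open>The least index makes \<open>a i\<close> adjacent to every other
      \<open>b j\<close>, so one \<open>x\<close> serves all of \<open>T\<close>.\<close>
    define i where "i = Min S"
    have i: "i \<in> S" "\<And>j. j \<in> S \<Longrightarrow> j \<noteq> i \<Longrightarrow> i < j"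
      using False Suc.prems(1) by (auto simp: i_def order.not_eq_order_implies_strict)
    define T where "T = S - {i}"
    have single: "\<not> eval (\<lambda>v. v = a j) F" "\<not> eval (\<lambda>v. v = b j) F" if "j \<in> S" for j
      using Suc.prems(3)[OF that that] eval_mono[of _ F "\<lambda>v. v = a j \<or> v = b j"] by auto
    have "reducible F (b ` T) (occurrences F (a i))"
      using i Suc.prems(3) single by (intro reducible_minterms) (auto simp: T_def)
    then have "reducible F (b ` T) k"
      using Suc.prems(4)[OF i(1)] by (rule reducible_mono)
    then obtain J' F' where J': "J' \<subseteq> b ` T" "card (b ` T) \<le> k * card J'"
      "saves F F' J'"
      unfolding reducible_def by blast
    then have F': "\<forall>v. occurrences F' v \<le> occurrences F v"
        "\<forall>y\<in>J'. occurrences F' y < occurrences F y"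
        "\<forall>\<sigma>. \<forall>y\<in>J'. \<sigma> y \<longrightarrow> eval \<sigma> F' = eval \<sigma> F"
      unfolding saves_def by blast+
    obtain U where U: "U \<subseteq> T" "J' = b ` U"
      using J'(1) by (meson subset_imageE)
    have US: "U \<subseteq> S" and injT: "inj_on b T" and injU: "inj_on b U"
      using U(1) Suc.prems(2) by (auto simp: T_def intro: inj_on_subset)
    \<comment> \<open>On \<open>U\<close> the formula \<open>F'\<close> still defines the same
      order, and each \<open>b j\<close> has lost an occurrence.\<close>
    have "card U \<le> (k + 1) ^ m"
    proof (rule Suc.IH)
      show "finite U" using US Suc.prems(1) by (rule finite_subset)
      show "eval (\<lambda>v. v = a i \<or> v = b j) F' \<longleftrightarrow> i < j" if "i \<in> U" "j \<in> U" for i j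
        using F'(3)[rule_format, of "b j" "\<lambda>v. v = a i \<or> v = b j"] Suc.prems(3)[of i j]
          US U(2) that by auto
      show "occurrences F' (a i) \<le> k" if "i \<in> U" for i
        using F'(1)[rule_format, of "a i"] Suc.prems(4)[of i] US that by auto
      show "occurrences F' (b j) \<le> m" if "j \<in> U" for j
        using F'(2)[rule_format, of "b j"] Suc.prems(5)[of j] US U(2) that by auto
    qed (fact injU)
    then have "k * card U \<le> k * (k + 1) ^ m" by simp
    moreover have "card T \<le> k * card U"
      using J'(2) U(2) injT injU by (simp add: card_image)
    moreover have "card S = Suc (card T)"
      using i(1) Suc.prems(1) unfolding T_def by (metis card_Suc_Diff1)
    \<comment> \<open>The base is \<open>k + 1\<close> rather than \<open>k\<close> to absorb the
      removed index \<open>i\<close>.\<close>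
    moreover have "1 \<le> (k + 1) ^ m" by simp
    ultimately show ?thesis
      unfolding power_Suc add_mult_distrib by linarith
  qed simp
qed

text \<open>The summand 1 arises because \<open>Suc i\<close> must not exceed \<open>n\<close>,
  which leaves \<open>n - 1\<close> indices.\<close>

lemma half_graph_readability_bound:
  assumes "n \<ge> 1"
  shows "n \<le> (readability (Gn n) + 1) ^ readability (Gn n) + 1"
proof -
  let ?k = "readability (Gn n)"
  obtain F where F: "read ?k F" "equivalent F (graph_formula (Gn n))"
    using readability_attained[OF finite_edges_Gn edges_Gn_nonempty[OF assms] Gn_simple[of _ n]
      equalityD1[OF Gn_no_isolated]] by blast
  have ev: "eval \<sigma> F \<longleftrightarrow> (\<exists>u v. {u, v} \<in> edges (Gn n) \<and> \<sigma> u \<and> \<sigma> v)" for \<sigma>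
    using F(2) eval_graph_formula[OF finite_edges_Gn edges_Gn_nonempty[OF assms] Gn_simple[of _ n]]
    unfolding equivalent_def by blast
  \<comment> \<open>The shift from \<open>X i\<close> to \<open>X (Suc i)\<close> makes the pairs with equal index non-adjacent,
    so that no vertex satisfies the formula, or a reduction of it, alone.\<close>
  have "card {1..<n} \<le> (?k + 1) ^ ?k"
  proof (rule card_half_graph_le)
    fix i j assume "i \<in> {1..<n}" "j \<in> {1..<n}"
    then have "{X (Suc i), Y j} \<in> edges (Gn n) \<longleftrightarrow> i < j"
      and "{X (Suc i)} \<notin> edges (Gn n)" "{Y j} \<notin> edges (Gn n)"
      by (auto simp: Gn_def doubleton_eq_iff)
    \<comment> \<open>\<open>ev\<close> also ranges over \<open>u = v\<close>, which is excluded
      because singletons are not edges.\<close>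
    then show "eval (\<lambda>v. v = X (Suc i) \<or> v = Y j) F \<longleftrightarrow> i < j"
      unfolding ev by (auto simp: insert_commute)
  qed (use F(1) in \<open>auto simp: read_def inj_on_def\<close>)
  then show ?thesis by simp
qed

theorem theorem1p3:
  shows "\<exists>c>0. \<exists>N::nat. \<forall>n\<ge>N. real (readability (Gn n)) \<ge> c * sqrt (ln (real n) / ln (ln (real n)))"
proof (intro exI[of _ "1/2::real"] conjI exI[of _ "nat \<lceil>exp (exp (1::real))\<rceil>"] allI impI)
  fix n :: nat assume "n \<ge> nat \<lceil>exp (exp (1::real))\<rceil>"
  then have n: "exp (exp 1) \<le> real n" by linarith
  define L where "L = ln (real n)"
  define k where "k = readability (Gn n)"
  have npos: "0 < real n" using n exp_gt_zero[of "exp 1::real"] by linarith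
  have L: "exp 1 \<le> L" unfolding L_def using n npos by (simp add: ln_ge_iff)
  have L0: "0 < L" using L exp_gt_zero[of "1::real"] by linarith
  \<comment> \<open>The cutoff \<open>exp (exp 1)\<close> is chosen for this: dividing by
    \<open>ln L\<close> cannot increase \<open>L\<close>.\<close>
  have lnL: "1 \<le> ln L" using L L0 by (simp add: ln_ge_iff)
  have nk: "n \<le> (k + 1) ^ k + 1"
    unfolding k_def using npos by (intro half_graph_readability_bound) simp
  have "2 < n"
  proof -
    have "(2::real) \<le> exp 1" using exp_ge_add_one_self[of "1::real"] by simp
    moreover have "1 + exp 1 \<le> exp (exp (1::real))" by (rule exp_ge_add_one_self)
    ultimately show ?thesis using n by linarith
  qed
  \<comment> \<open>For \<open>k = 0\<close> the bound would read \<open>n \<le> 2\<close>.\<close>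
  then have k1: "1 \<le> k" using nk by (cases k) auto
  have "n \<le> 2 * (k + 1) ^ k"
    using nk one_le_power[of "k + 1" k] by linarith
  then have "real n \<le> real (2 * (k + 1) ^ k)"
    by (rule of_nat_mono)
  then have "real n \<le> 2 * (real k + 1) ^ k"
    by (simp add: add.commute)
  then have "L \<le> ln (2 * (real k + 1) ^ k)"
    unfolding L_def using npos by (simp add: ln_mono)
  also have "\<dots> = ln 2 + real k * ln (1 + real k)"
    by (simp add: ln_mult_pos ln_realpow add.commute)
  \<comment> \<open>The crude bounds \<open>ln 2 \<le> 1\<close> and
    \<open>ln (1 + k) \<le> k\<close> give \<open>L \<le> (2 * k)\<^sup>2\<close>, whence the
    constant \<open>1/2\<close>.\<close>
  also have "\<dots> \<le> 1 + real k * real k"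
    using ln_add_one_self_le_self[of "real k"] ln_le_minus_one[of "2::real"]
    by (intro add_mono mult_left_mono) auto
  also have "\<dots> \<le> (2 * real k)\<^sup>2"
    using k1 mult_mono[of 1 "real k" 1 "real k"] by (simp add: power2_eq_square)
  finally have "sqrt L \<le> 2 * real k" by (simp add: real_le_lsqrt)
  moreover have "sqrt (L / ln L) \<le> sqrt L"
  proof -
    have "L / ln L \<le> L / 1"
      by (rule divide_left_mono) (use L0 lnL in linarith)+
    then show ?thesis by simp
  qed
  ultimately show "1/2 * sqrt (ln (real n) / ln (ln (real n))) \<le> real (readability (Gn n))"
    unfolding L_def k_def by linarith
qed simp

end
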